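(* Let $q,N,H,Q$ be positive integers with $q\ll N$ and $Q\ll N$ as $N\to\infty$. Let $f:\mathbb{N}\to\mathbb{R}$ be a sieve function of range $Q$ and let $w:\mathbb{R}\to\mathbb{R}$ be any weight. Then, for every $\varepsilon>0$, $$T_{w,f}(q,N,H)\ll_{\varepsilon} N^{\varepsilon}\Big(\frac{N}{q}+q+Q\Big)\max_{\ell>1,\ \ell\mid q}\mathcal{L}^{1}_{\ell}(\widehat{w_H}).$$
   Context: An arithmetic function $g:\mathbb{N}\to\mathbb{C}$ is essentially bounded if $g(d)\ll_\varepsilon d^\varepsilon$ for every $\varepsilon>0$. A function $f$ is a sieve function of range $Q$ if $f(n)=\sum_{d\mid n,\,d\le Q} g(d)$ for some essentially bounded $g$ (equivalently $f=g_Q*\mathbf{1}$ with $g_Q=g\cdot\mathbf{1}_{[1,Q]}$). Notation: $e(\alpha)=e^{2\pi i\alpha}$; $n\sim N$ means $n\in(N,2N]\cap\mathbb{N}$; sums $\sum_{a\le H}$ are over $a\ge1$. For a weight $w:\mathbb{R}\to\mathbb{R}$, set $w_H(h)=w(h)$ if $h\in[-H,H]\cap\mathbb{Z}$ and $0$ otherwise, $\widehat{w_H}(\beta)=\sum_{0\le|h|\le H}w(h)e(h\beta)$, and $\mathcal{L}^1_\ell(\widehat{w_H})=\frac1\ell\sum_{j<\ell,\,(j,\ell)=1}|\widehat{w_H}(j/\ell)|$. Finally $$T_{w,f}(q,N,H)=\sum_{0\le|a|\le H}w(a)\sum_{n\sim N,\ n\equiv a\ (\mathrm{mod}\ q)}f(n)-\frac1q\sum_{0\le|h|\le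 H}w(h)\sum_{n\sim N}f(n).$$ *)

theory Defs
  imports Complex_Main "HOL-Number_Theory.Cong"
begin

definition essentially_bounded :: "(nat \<Rightarrow> complex) \<Rightarrow> bool" where
  "essentially_bounded g \<longleftrightarrow>
     (\<forall>\<epsilon>>0. \<exists>C. \<forall>d\<ge>1. norm (g d) \<le> C * real d powr \<epsilon>)"

text \<open>
  The same with the implied constants named: \<open>K \<epsilon>\<close> is a constant for the exponent \<open>\<epsilon>\<close>.
  For a single fixed \<open>Q\<close> the truncation of any \<open>g\<close> to \<open>[1, Q]\<close> is essentially bounded, so an
  asymptotic bound in which \<open>Q\<close> varies with \<open>N\<close> has meaning only relative to such a \<open>K\<close>.
\<close>

definition essentially_bounded_by :: "(real \<Rightarrow> real) \<Rightarrow> (nat \<Rightarrow> complex) \<Rightarrow> bool" where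
  "essentially_bounded_by K g \<longleftrightarrow>
     (\<forall>\<epsilon>>0. \<forall>d\<ge>1. norm (g d) \<le> K \<epsilon> * real d powr \<epsilon>)"

lemma essentially_bounded_iff: "essentially_bounded g \<longleftrightarrow> (\<exists>K. essentially_bounded_by K g)"
  unfolding essentially_bounded_def essentially_bounded_by_def by metis

definition sieve_function :: "(real \<Rightarrow> real) \<Rightarrow> nat \<Rightarrow> (nat \<Rightarrow> real) \<Rightarrow> bool" where
  "sieve_function K Q f \<longleftrightarrow>
     (\<exists>g. essentially_bounded_by K g \<and>
          (\<forall>n\<ge>1. complex_of_real (f n) = (\<Sum>d | d dvd n \<and> d \<le> Q. g d)))"

definition e :: "real \<Rightarrow> complex" where
  "e \<alpha> = exp (2 * complex_of_real pi * \<i> * complex_of_real \<alpha>)"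

definition w_hat :: "(real \<Rightarrow> real) \<Rightarrow> nat \<Rightarrow> real \<Rightarrow> complex" where
  "w_hat w H \<beta> =
     (\<Sum>h\<in>{- int H..int H}. complex_of_real (w (real_of_int h)) * e (real_of_int h * \<beta>))"

definition L1 :: "(real \<Rightarrow> real) \<Rightarrow> nat \<Rightarrow> nat \<Rightarrow> real" where
  "L1 w H l = 1 / real l * (\<Sum>j | j < l \<and> coprime j l. norm (w_hat w H (real j / real l)))"

text \<open>For \<open>q = 1\<close> there is no divisor \<open>l > 1\<close>; the empty maximum of nonnegative numbers is \<open>0\<close>.\<close>

definition max_L1 :: "(real \<Rightarrow> real) \<Rightarrow> nat \<Rightarrow> nat \<Rightarrow> real" where
  "max_L1 w H q = (if q = 1 then 0 else Max {L1 w H l | l. l > 1 \<and> l dvd q})"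

definition T :: "(real \<Rightarrow> real) \<Rightarrow> (nat \<Rightarrow> real) \<Rightarrow> nat \<Rightarrow> nat \<Rightarrow> nat \<Rightarrow> real" where
  "T w f q N H =
     (\<Sum>a\<in>{- int H..int H}. w (real_of_int a) *
        (\<Sum>n | n \<in> {N<..2 * N} \<and> [int n = a] (mod int q). f n))
     - 1 / real q * (\<Sum>h\<in>{- int H..int H}. w (real_of_int h)) * (\<Sum>n\<in>{N<..2 * N}. f n)"

end

theory Submission
  imports Defs
begin

text \<open>
  Detecting \<open>n \<equiv> a (mod q)\<close> by additive characters gives
  \<open>q T = \<Sum>\<^bsub>0<j<q\<^esub> w_hat(j/q) F(-j/q)\<close> with \<open>F(\<beta>) = \<Sum>\<^bsub>n\<sim>N\<^esub> f(n) e(n\<beta>)\<close>: the subtracted main term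
  is exactly the frequency \<open>j = 0\<close>. At a reduced fraction \<open>j/l\<close>, opening \<open>f\<close> turns \<open>F\<close> into
  geometric sums over the multiples of each \<open>d \<le> Q\<close>. Those with \<open>l dvd d\<close> have at most \<open>2N/d\<close> terms
  and contribute \<open>(N/l) log N\<close>; each of the others is controlled by the distance of \<open>dj/l\<close> to the
  nearest integer, and as \<open>d\<close> runs through a period modulo \<open>l\<close> these bounds add up to \<open>l log l\<close>.
  Thus \<open>F(j/l)\<close> is at most \<open>N/l + Q + l\<close> up to factors \<open>N\<^sup>\<epsilon>\<close>. Grouping the \<open>j/q\<close> by their reduced
  denominators \<open>l\<close> produces \<open>L1 w H l\<close>, and the divisor bound absorbs the sum over \<open>l dvd q\<close>.
\<close>

section \<open>Additive characters\<close>

lemma e_eq_cis: "e x = cis (2 * pi * x)"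
  by (simp add: e_def cis_conv_exp mult_ac)

lemma norm_e [simp]: "norm (e x) = 1"
  by (simp add: e_eq_cis)

lemma e_add: "e (x + y) = e x * e y"
  by (simp add: e_eq_cis cis_mult distrib_left)

lemma e_uminus: "e (- x) = cnj (e x)"
  by (simp add: e_eq_cis cis_cnj)

lemma e_power: "e x ^ n = e (real n * x)"
  by (simp add: e_eq_cis DeMoivre mult_ac)

lemma e_of_int [simp]: "e (of_int k) = 1"
  by (simp add: e_eq_cis cis_multiple_2pi)

lemma e_eq_1_imp_Ints:
  assumes "e x = 1"
  shows "x \<in> \<int>"
proof -
  have "cos (2 * pi * x) = 1"
    using assms by (simp add: e_eq_cis complex_eq_iff)
  then obtain n :: int where "2 * pi * x = of_int n * 2 * pi"
    using cos_one_2pi_int by blast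
  then have "x = of_int n" by simp
  then show ?thesis by simp
qed

lemma e_mod:
  assumes "l > 0"
  shows "e (real (m mod l) / real l) = e (real m / real l)"
proof -
  have "real m = real (m div l * l + m mod l)" by (simp only: div_mult_mod_eq)
  then have "real m / real l = real_of_int (int (m div l)) + real (m mod l) / real l"
    using assms by (simp only: of_nat_add of_nat_mult) (simp add: add_divide_distrib)
  then show ?thesis by (simp only: e_add e_of_int mult_1)
qed

text \<open>Orthogonality of additive characters: if \<open>int q\<close> does not divide
  \<open>k\<close>, the summands are the powers of some \<open>z\<close> with
  \<open>z ^ q = 1\<close> and \<open>z\<close> different from 1, so the geometric series
  vanishes.\<close>

lemma sum_e_residue:
  assumes "q > 0"
  shows "(\<Sum>j<q. e (real j * (of_int k / real q))) = (if int q dvd k then of_nat q else 0)"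
proof (cases "int q dvd k")
  case True
  then obtain m where "k = int q * m" by blast
  then have "e (real j * (of_int k / real q)) = 1" for j
    using assms e_of_int[of "int j * m"] by simp
  with True show ?thesis by simp
next
  case False
  define z where "z = e (of_int k / real q)"
  have "z \<noteq> 1"
  proof
    assume "z = 1"
    then have "of_int k / real q \<in> \<int>"
      using e_eq_1_imp_Ints by (simp add: z_def)
    then obtain m where "of_int k / real q = of_int m"
      by (auto elim: Ints_cases)
    then have "real_of_int k = of_int (int q * m)"
      using assms by (simp add: field_simps)
    then have "k = int q * m" by (simp only: of_int_eq_iff)
    with False show False by simp
  qed
  moreover have "z ^ q = 1"
    using assms by (simp add: z_def e_power)
  ultimately have "(\<Sum>j<q. z ^ j) = 0"
    by (simp add: sum_gp_strict)
  with False show ?thesis by (simp add: z_def e_power)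
qed

section \<open>Geometric sums and the distance to the nearest integer\<close>

text \<open>The closed form has a numerator of norm at most 2, so the bound does not depend on the
  length of the range.\<close>

lemma norm_sum_power_le:
  fixes z :: complex
  assumes "norm z = 1" "z \<noteq> 1"
  shows "norm (\<Sum>m\<in>{a..<b}. z ^ m) \<le> 2 / norm (1 - z)"
proof (cases "a \<le> b")
  case True
  have "(\<Sum>m\<in>{a..<b}. z ^ m) = (\<Sum>m<b. z ^ m) - (\<Sum>m<a. z ^ m)"
    using True sum_diff_nat_ivl[of 0 a b "\<lambda>m. z ^ m"] by (simp add: atLeast0LessThan)
  also have "\<dots> = (z ^ a - z ^ b) / (1 - z)"
    using assms by (simp add: sum_gp_strict flip: diff_divide_distrib)
  also have "norm \<dots> \<le> 2 / norm (1 - z)"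
    using assms norm_triangle_ineq4[of "z ^ a" "z ^ b"]
    by (auto simp: norm_divide norm_power intro!: divide_right_mono)
  finally show ?thesis .
qed simp

text \<open>A crude form of Jordan's inequality. Below 1/6 the mean value theorem applies with
  cosine at least 1/2 and \<open>pi\<close> at least 2; above 1/6 monotonicity gives a sine of at
  least 1/2, which exceeds or equals \<open>t\<close>.\<close>

lemma sin_pi_mult_ge:
  assumes "0 \<le> t" "t \<le> 1 / 2"
  shows "t \<le> sin (pi * t)"
proof (cases "t < 1 / 6")
  case True
  show ?thesis
  proof (cases "t = 0")
    case False
    with assms have t: "0 < pi * t" by simp
    obtain z where z: "0 < z" "z < pi * t" "sin (pi * t) - sin 0 = (pi * t - 0) * cos z"
      using MVT2[OF t, of sin cos] by (auto intro!: derivative_eq_intros)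
    have "pi * t \<le> pi / 3"
      using True by (simp add: field_simps)
    then have "cos (pi / 3) \<le> cos z"
      using z by (intro cos_monotone_0_pi_le) (simp_all del: divide_const_simps)
    then have "1 \<le> pi * cos z"
      using mult_mono[of 2 pi "1 / 2" "cos z"] pi_ge_two by (simp add: cos_60)
    then have "t * 1 \<le> t * (pi * cos z)"
      using assms by (intro mult_left_mono) auto
    with z show ?thesis by (simp add: mult_ac)
  qed simp
next
  case False
  then have "sin (pi / 6) \<le> sin (pi * t)"
    using assms by (intro sin_monotone_2pi_le) (auto simp: field_simps)
  with assms show ?thesis by (simp add: sin_30)
qed

lemma norm_one_minus_e: "norm (1 - e x) = 2 * \<bar>sin (pi * x)\<bar>"
proof -
  define s c where "s = sin (pi * x)" and "c = cos (pi * x)"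
  have sc: "s\<^sup>2 + c\<^sup>2 = 1" by (simp add: s_def c_def)
  have "1 - e x = Complex (2 * s\<^sup>2) (- (2 * s * c))"
    using cos_double_sin[of "pi * x"] sin_double[of "pi * x"]
    by (simp add: e_eq_cis complex_eq_iff s_def c_def mult_ac)
  then have "norm (1 - e x) = sqrt ((2 * s\<^sup>2)\<^sup>2 + (2 * s * c)\<^sup>2)"
    by (simp add: complex_norm)
  also have "(2 * s\<^sup>2)\<^sup>2 + (2 * s * c)\<^sup>2 = (2 * s)\<^sup>2 * (s\<^sup>2 + c\<^sup>2)"
    by algebra
  finally show ?thesis by (simp add: sc) (simp add: s_def abs_mult real_sqrt_mult)
qed

text \<open>The norm is controlled by the smaller of \<open>x\<close> and \<open>1 - x\<close>.
  Adding both reciprocals avoids the minimum and makes the later sum over residues split into two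
  harmonic sums.\<close>

lemma two_over_norm_one_minus_e_le:
  assumes "0 < x" "x < 1"
  shows "2 / norm (1 - e x) \<le> 1 / x + 1 / (1 - x)"
proof (cases "x \<le> 1 / 2")
  case True
  have "x \<le> sin (pi * x)" using True assms by (intro sin_pi_mult_ge) auto
  then have "2 / norm (1 - e x) \<le> 1 / x"
    using assms by (simp add: norm_one_minus_e frac_le)
  also have "\<dots> \<le> 1 / x + 1 / (1 - x)" using assms by simp
  finally show ?thesis .
next
  case False
  have "1 - x \<le> sin (pi * (1 - x))" using False assms by (intro sin_pi_mult_ge) auto
  also have "\<dots> = sin (pi * x)" by (simp add: right_diff_distrib sin_diff)
  finally have "2 / norm (1 - e x) \<le> 1 / (1 - x)"
    using assms by (simp add: norm_one_minus_e frac_le)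
  also have "\<dots> \<le> 1 / x + 1 / (1 - x)" using assms by simp
  finally show ?thesis .
qed

section \<open>Harmonic sums and the divisor bound\<close>

text \<open>Each new term is at most the increment of the logarithm, by \<open>ln y <= y - 1\<close>
  at \<open>y = n / (n + 1)\<close>.\<close>

lemma sum_inverse_le_ln:
  assumes "n \<ge> 1"
  shows "(\<Sum>k=1..n. 1 / real k) \<le> 1 + ln (real n)"
  using assms
proof (induction n rule: dec_induct)
  case base
  show ?case by simp
next
  case (step n)
  have "ln (real n / real (Suc n)) \<le> real n / real (Suc n) - 1"
    using step.hyps by (intro ln_le_minus_one) auto
  also have "\<dots> = - 1 / real (Suc n)"
    by (simp add: field_simps)
  finally have "1 / real (Suc n) \<le> ln (real (Suc n)) - ln (real n)"
    using step.hyps by (simp add: ln_div)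
  with step.IH show ?case by simp
qed

lemma sum_inverse_le_powr:
  assumes "\<delta> > 0" "n \<ge> 1" "real n \<le> x"
  shows "(\<Sum>k=1..n. 1 / real k) \<le> (1 + 1 / \<delta>) * x powr \<delta>"
proof -
  have x: "1 \<le> x" using assms by linarith
  have "(\<Sum>k=1..n. 1 / real k) \<le> 1 + ln (real n)"
    by (rule sum_inverse_le_ln) fact
  also have "\<dots> \<le> 1 + ln x" using assms by simp
  also have "\<dots> \<le> x powr \<delta> + x powr \<delta> / \<delta>"
    using x assms by (intro add_mono ln_powr_bound ge_one_powr_ge_zero) auto
  finally show ?thesis by (simp add: algebra_simps)
qed

section \<open>The divisor bound\<close>

text \<open>Handles the small primes in the divisor bound: the constant is uniform in
  \<open>x\<close> and \<open>a\<close>. The factor 2 comes from \<open>ln x >= 1/2\<close>.\<close>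

lemma Suc_le_const_mult_powr:
  fixes x \<delta> :: real
  assumes "\<delta> > 0" "x \<ge> 2"
  shows "real a + 1 \<le> (1 + 1 / \<delta>) * 2 * (x ^ a) powr \<delta>"
proof -
  have "ln (1 / 2 :: real) \<le> 1 / 2 - 1" by (rule ln_le_minus_one) simp
  then have "1 / 2 \<le> ln (2 :: real)" by (simp add: ln_div)
  also have "\<dots> \<le> ln x" using assms by simp
  finally have "real a * (1 / 2) \<le> real a * ln x" by (intro mult_left_mono) auto
  also have "\<dots> = ln (x ^ a)" using assms by (simp add: ln_realpow)
  also have "\<dots> \<le> (x ^ a) powr \<delta> / \<delta>"
    using assms by (intro ln_powr_bound) auto
  finally have "real a \<le> 2 * ((x ^ a) powr \<delta> / \<delta>)" by linarith
  moreover have "1 \<le> (x ^ a) powr \<delta>"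
    using assms by (intro ge_one_powr_ge_zero) auto
  ultimately have "real a + 1 \<le> 2 * ((x ^ a) powr \<delta> / \<delta>) + 2 * (x ^ a) powr \<delta>" by linarith
  then show ?thesis by (simp add: algebra_simps)
qed

text \<open>Every divisor is a product \<open>p ^ i * d\<close> with \<open>i <= a\<close> and
  \<open>d\<close> dividing \<open>m\<close>, so the pairs \<open>(i, d)\<close> cover all
  divisors.\<close>

lemma card_divisors_prime_power_mult_le:
  fixes p m :: nat
  assumes "prime p" "m > 0"
  shows "card {d. d dvd p ^ a * m} \<le> (a + 1) * card {d. d dvd m}"
proof -
  have "{d. d dvd p ^ a * m} \<subseteq> (\<lambda>(i, d). p ^ i * d) ` ({..a} \<times> {d. d dvd m})"
  proof
    fix x assume "x \<in> {d. d dvd p ^ a * m}"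
    then obtain b c where bc: "x = b * c" "b dvd p ^ a" "c dvd m"
      using division_decomp by blast
    then obtain i where "i \<le> a" "b = p ^ i"
      using divides_primepow_nat assms by blast
    with bc show "x \<in> (\<lambda>(i, d). p ^ i * d) ` ({..a} \<times> {d. d dvd m})"
      by force
  qed
  then have "card {d. d dvd p ^ a * m} \<le> card ({..a} \<times> {d. d dvd m})"
    using assms by (intro surj_card_le) auto
  then show ?thesis by (simp add: card_cartesian_product)
qed

text \<open>Prime powers are split off one at a time. A factor \<open>p ^ a\<close> costs
  \<open>a + 1\<close> divisors against a gain of \<open>(p ^ a) powr \<delta>\<close>; only primes
  below a fixed threshold can lose, each by a factor of at most \<open>M\<close>.\<close>

lemma card_divisors_le_powr:
  fixes \<delta> :: real
  assumes "\<delta> > 0"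
  obtains C where "C > 0" "\<And>n. n > 0 \<Longrightarrow> real (card {d. d dvd n}) \<le> C * real n powr \<delta>"
proof -
  define M where "M = (1 + 1 / \<delta>) * 2"
  \<comment> \<open>From this threshold on \<open>p powr \<delta>\<close> is at least 2, hence
    \<open>(p ^ a) powr \<delta>\<close> is at least \<open>2 ^ a\<close> and so at least
    \<open>a + 1\<close>.\<close>
  define P where "P = nat \<lceil>2 powr (1 / \<delta>)\<rceil>"
  have M: "M \<ge> 1" using assms by (simp add: M_def field_simps)
  \<comment> \<open>The exponent counts every divisor of \<open>n\<close> below \<open>P\<close>,
    prime or not. Passing from \<open>m\<close> to \<open>n\<close> adds at least the new element
    \<open>p\<close> when \<open>p < P\<close>, which pays for the factor \<open>M\<close>.\<close>
  have bound: "real (card {d. d dvd n}) \<le> M ^ card {p. p < P \<and> p dvd n} * real n powr \<delta>" if "n > 0" for n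
    using that
  proof (induction n rule: less_induct)
    case (less n)
    show ?case
    proof (cases "n = 1")
      case False
      then obtain p where p: "prime p" "p dvd n" using prime_factor_nat by blast
      obtain m where m: "n = p ^ multiplicity p n * m" "\<not> p dvd m"
        using multiplicity_decompose'[of n p] less.prems p by (metis not_prime_unit not_gr_zero)
      define a where "a = multiplicity p n"
      have n: "n = p ^ a * m" using m by (simp add: a_def)
      have a: "a > 0" using p less.prems by (simp add: a_def prime_multiplicity_gt_zero_iff)
      have m0: "m > 0" using m less.prems by (cases m) auto
      have pa: "p ^ a > 1" using p a by (intro one_less_power prime_gt_1_nat)
      then have "m < n" using m0 n by simp
      note IH = less.IH[OF this m0]
      define k where "k = (if p < P then 1 else 0 :: nat)"
      have fac: "real a + 1 \<le> M ^ k * real (p ^ a) powr \<delta>"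
      proof (cases "p < P")
        case True
        then show ?thesis
          using Suc_le_const_mult_powr[OF assms, of "real p" a] prime_ge_2_nat[OF p(1)]
          by (simp add: k_def M_def)
      next
        case False
        then have "2 powr (1 / \<delta>) \<le> real p" by (simp add: P_def not_less nat_le_iff ceiling_le_iff)
        then have "(2 powr (1 / \<delta>)) powr \<delta> \<le> real p powr \<delta>"
          using assms by (intro powr_mono2) auto
        then have "2 \<le> real p powr \<delta>" using assms by (simp add: powr_powr)
        then have "2 ^ a \<le> (real p powr \<delta>) ^ a" by (intro power_mono) auto
        also have "\<dots> = real (p ^ a) powr \<delta>"
          using p by (simp add: powr_realpow[symmetric] prime_gt_0_nat powr_powr mult.commute)
        finally have *: "2 ^ a \<le> real (p ^ a) powr \<delta>" .
        have "real (a + 1) \<le> real (2 ^ a)"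
          unfolding of_nat_le_iff by (induction a) auto
        with * False show ?thesis by (simp add: k_def)
      qed
      have "card {p. p < P \<and> p dvd m} + k \<le> card {p. p < P \<and> p dvd n}"
      proof (cases "p < P")
        case True
        have "insert p {p. p < P \<and> p dvd m} \<subseteq> {p. p < P \<and> p dvd n}"
          using True p n by auto
        then have "card (insert p {p. p < P \<and> p dvd m}) \<le> card {p. p < P \<and> p dvd n}"
          by (intro card_mono) auto
        with m True show ?thesis by (simp add: k_def)
      next
        case False
        have "{p. p < P \<and> p dvd m} \<subseteq> {p. p < P \<and> p dvd n}" using n by auto
        then have "card {p. p < P \<and> p dvd m} \<le> card {p. p < P \<and> p dvd n}"
          by (intro card_mono) auto
        with False show ?thesis by (simp add: k_def)
      qed
      note cards = this
      have "real (card {d. d dvd n}) \<le> real ((a + 1) * card {d. d dvd m})"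
        unfolding n of_nat_le_iff by (rule card_divisors_prime_power_mult_le) (use p m0 in auto)
      also have "\<dots> = (real a + 1) * real (card {d. d dvd m})" by (simp add: algebra_simps)
      also have "\<dots> \<le> (M ^ k * real (p ^ a) powr \<delta>) * (M ^ card {p. p < P \<and> p dvd m} * real m powr \<delta>)"
        using fac IH M by (intro mult_mono) auto
      also have "\<dots> = M ^ (card {p. p < P \<and> p dvd m} + k) * real n powr \<delta>"
        by (simp add: n powr_mult power_add mult_ac)
      also have "\<dots> \<le> M ^ card {p. p < P \<and> p dvd n} * real n powr \<delta>"
        using cards M by (intro mult_right_mono power_increasing) auto
      finally show ?thesis .
    qed (use M in auto)
  qed
  show ?thesis
  proof (rule that[of "M ^ P"])
    show "M ^ P > 0" using M by simp
    fix n :: nat assume n: "n > 0"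
    have "card {p. p < P \<and> p dvd n} \<le> card {..<P}" by (intro card_mono) auto
    then have "M ^ card {p. p < P \<and> p dvd n} \<le> M ^ P"
      using M by (intro power_increasing) auto
    then have "M ^ card {p. p < P \<and> p dvd n} * real n powr \<delta> \<le> M ^ P * real n powr \<delta>"
      by (intro mult_right_mono) auto
    with bound[OF n] show "real (card {d. d dvd n}) \<le> M ^ P * real n powr \<delta>" by linarith
  qed
qed

section \<open>Exponential sums of sieve functions\<close>

text \<open>Writing \<open>n = d * m\<close>, the condition \<open>a < n <= b\<close> becomes
  \<open>a div d < m <= b div d\<close>; the half-open form suits
  \<open>norm_sum_power_le\<close>.\<close>

lemma sum_multiples_greaterThanAtMost:
  fixes F :: "nat \<Rightarrow> 'a :: comm_monoid_add"
  assumes "d > 0"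
  shows "(\<Sum>n | n \<in> {a<..b} \<and> d dvd n. F n) = (\<Sum>m\<in>{Suc (a div d)..<Suc (b div d)}. F (d * m))"
proof (rule sum.reindex_bij_witness[of _ "\<lambda>m. d * m" "\<lambda>n. n div d"])
  fix m assume "m \<in> {Suc (a div d)..<Suc (b div d)}"
  then show "d * m \<in> {n. n \<in> {a<..b} \<and> d dvd n}"
    using assms by (auto simp: Suc_le_eq less_Suc_eq_le div_less_iff_less_mult less_eq_div_iff_mult_less_eq mult.commute)
next
  fix n assume "n \<in> {n. n \<in> {a<..b} \<and> d dvd n}"
  then show "n div d \<in> {Suc (a div d)..<Suc (b div d)}"
    using assms by (auto simp: Suc_le_eq less_Suc_eq_le div_less_iff_less_mult less_eq_div_iff_mult_less_eq mult.commute)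
qed (use assms in auto)

text \<open>
  For \<open>0 < r < l\<close> this bounds every geometric sum of ratio \<open>e (r / l)\<close>; the value at \<open>r = 0\<close> is set
  to \<open>0\<close> because the multiples of \<open>l\<close> are counted separately.
\<close>

definition residue_weight :: "nat \<Rightarrow> nat \<Rightarrow> real" where
  "residue_weight l r = (if r = 0 then 0 else real l * (1 / real r + 1 / real (l - r)))"

lemma residue_weight_nonneg: "residue_weight l r \<ge> 0"
  by (simp add: residue_weight_def)

text \<open>The reflection of \<open>r\<close> to \<open>l - r\<close> shows that both reciprocals
  contribute the same harmonic sum.\<close>

lemma sum_residue_weight_le:
  "(\<Sum>r<l. residue_weight l r) \<le> 2 * real l * (\<Sum>k=1..l. 1 / real k)"
proof -
  have "(\<Sum>r<l. residue_weight l r) = (\<Sum>r=1..<l. residue_weight l r)"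
    by (intro sum.mono_neutral_right) (auto simp: residue_weight_def Suc_le_eq)
  also have "\<dots> = real l * ((\<Sum>r=1..<l. 1 / real r) + (\<Sum>r=1..<l. 1 / real (l - r)))"
    by (simp add: residue_weight_def sum.distrib sum_distrib_left distrib_left)
  also have "(\<Sum>r=1..<l. 1 / real (l - r)) = (\<Sum>r=1..<l. 1 / real r)"
    by (rule sum.reindex_bij_witness[of _ "\<lambda>r. l - r" "\<lambda>r. l - r"]) auto
  also have "real l * ((\<Sum>r=1..<l. 1 / real r) + (\<Sum>r=1..<l. 1 / real r)) = 2 * real l * (\<Sum>r=1..<l. 1 / real r)"
    by simp
  also have "\<dots> \<le> 2 * real l * (\<Sum>k=1..l. 1 / real k)"
    by (intro mult_left_mono sum_mono2) auto
  finally show ?thesis .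
qed

text \<open>Multiplication by \<open>j\<close> permutes the residues modulo \<open>l\<close>, so a
  block of \<open>l\<close> consecutive integers meets every residue once.\<close>

lemma sum_periodic_block:
  fixes F :: "nat \<Rightarrow> real"
  assumes "coprime j l" "l > 0"
  shows "(\<Sum>d\<in>{m * l..<m * l + l}. F (d * j mod l)) = (\<Sum>r<l. F r)"
proof -
  have inj: "inj_on (\<lambda>d. d * j mod l) {..<l}"
  proof (rule inj_onI)
    fix x y assume "x \<in> {..<l}" "y \<in> {..<l}" "x * j mod l = y * j mod l"
    then have "[x * j = y * j] (mod l)" by (simp add: cong_def)
    then have "[x = y] (mod l)" using assms by (simp add: cong_mult_rcancel_nat)
    with \<open>x \<in> _\<close> \<open>y \<in> _\<close> show "x = y" by (simp add: cong_def)
  qed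
  have "(\<lambda>d. d * j mod l) ` {..<l} = {..<l}"
    by (rule endo_inj_surj) (use inj assms in auto)
  then have bij: "bij_betw (\<lambda>d. d * j mod l) {..<l} {..<l}"
    using inj by (simp add: bij_betw_def)
  have "(\<Sum>d\<in>{m * l..<m * l + l}. F (d * j mod l)) = (\<Sum>d<l. F ((d + m * l) * j mod l))"
    using sum.shift_bounds_nat_ivl[of "\<lambda>d. F (d * j mod l)" 0 "m * l" l]
    by (simp add: atLeast0LessThan add.commute)
  also have "\<dots> = (\<Sum>d<l. F (d * j mod l))"
    by (simp add: distrib_right mult.assoc mult.left_commute[of m l] mod_add_right_eq)
  also have "\<dots> = (\<Sum>r<l. F r)" by (rule sum.reindex_bij_betw[OF bij])
  finally show ?thesis .
qed

text \<open>The range is covered by \<open>Q div l + 1\<close> full periods; nonnegativity of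
  \<open>F\<close> allows the enlargement.\<close>

lemma sum_periodic_le:
  fixes F :: "nat \<Rightarrow> real"
  assumes "coprime j l" "l > 0" "\<And>r. F r \<ge> 0"
  shows "(\<Sum>d=1..Q. F (d * j mod l)) \<le> (real Q / real l + 1) * (\<Sum>r<l. F r)"
proof -
  define n where "n = Q div l + 1"
  have "Q < n * l"
    using assms dividend_less_div_times[of l Q] by (simp add: n_def)
  then have "(\<Sum>d=1..Q. F (d * j mod l)) \<le> (\<Sum>d<n * l. F (d * j mod l))"
    using assms by (intro sum_mono2) auto
  also have "\<dots> = (\<Sum>m<n. \<Sum>d\<in>{m * l..<m * l + l}. F (d * j mod l))"
    by (rule sum.nat_group[symmetric])
  also have "\<dots> = real n * (\<Sum>r<l. F r)"
    using assms by (simp add: sum_periodic_block)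
  also have "\<dots> \<le> (real Q / real l + 1) * (\<Sum>r<l. F r)"
    using of_nat_div_le_of_nat[of Q l] assms by (intro mult_right_mono sum_nonneg) (auto simp: n_def)
  finally show ?thesis .
qed

text \<open>Over the multiples \<open>d * m\<close> the terms form a geometric progression of ratio
  \<open>e (r / l)\<close> with \<open>r = d * j mod l\<close>. If \<open>l\<close> divides
  \<open>d\<close>, the terms are merely counted. Otherwise coprimality forces \<open>r\<close> to
  be nonzero and the geometric bound applies.\<close>

lemma norm_sum_e_multiples_le:
  assumes "coprime j l" "l > 0" "d > 0"
  shows "norm (\<Sum>n | n \<in> {N<..2 * N} \<and> d dvd n. e (real n * (real j / real l)))
           \<le> (if l dvd d then 2 * real N / real d else 0) + residue_weight l (d * j mod l)"
proof -
  define r where "r = d * j mod l"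
  define z where "z = e (real r / real l)"
  have z: "e (real (d * m) * (real j / real l)) = z ^ m" for m
  proof -
    have "z = e (real (d * j) / real l)" using assms by (simp add: z_def r_def e_mod)
    then show ?thesis by (simp add: e_power mult_ac)
  qed
  have eq: "(\<Sum>n | n \<in> {N<..2 * N} \<and> d dvd n. e (real n * (real j / real l)))
      = (\<Sum>m\<in>{Suc (N div d)..<Suc (2 * N div d)}. z ^ m)"
    using assms by (simp only: sum_multiples_greaterThanAtMost z)
  show ?thesis
  proof (cases "l dvd d")
    case True
    have "norm (\<Sum>m\<in>{Suc (N div d)..<Suc (2 * N div d)}. z ^ m) \<le> (\<Sum>m\<in>{Suc (N div d)..<Suc (2 * N div d)}. 1)"
      by (rule order_trans[OF norm_sum]) (simp add: z_def norm_power)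
    also have "\<dots> \<le> real (2 * N div d)" by simp
    also have "\<dots> \<le> 2 * real N / real d" using of_nat_div_le_of_nat[of "2 * N" d] by simp
    finally show ?thesis using True residue_weight_nonneg[of l "d * j mod l"] eq by simp
  next
    case False
    then have "\<not> l dvd d * j" using assms by (simp add: coprime_commute coprime_dvd_mult_left_iff)
    then have r: "0 < r" "r < l" using assms by (auto simp: r_def dvd_eq_mod_eq_0)
    then have x: "0 < real r / real l" "real r / real l < 1" by auto
    have "z \<noteq> 1"
    proof
      assume "z = 1"
      then have "real r / real l \<in> \<int>" unfolding z_def by (rule e_eq_1_imp_Ints)
      then obtain k where "real r / real l = of_int k" by (auto elim: Ints_cases)
      with x show False by simp
    qed
    then have "norm (\<Sum>m\<in>{Suc (N div d)..<Suc (2 * N div d)}. z ^ m) \<le> 2 / norm (1 - z)"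
      by (intro norm_sum_power_le) (simp_all add: z_def)
    also have "\<dots> \<le> 1 / (real r / real l) + 1 / (1 - real r / real l)"
      unfolding z_def by (rule two_over_norm_one_minus_e_le) (fact x)+
    also have "\<dots> = residue_weight l r"
      using r by (simp add: residue_weight_def of_nat_diff field_simps)
    finally show ?thesis using False eq by (simp add: r_def)
  qed
qed

lemma sum_inverse_multiples_le:
  assumes "l > 0"
  shows "(\<Sum>d | d \<in> {1..n} \<and> l dvd d. 1 / real d) \<le> 1 / real l * (\<Sum>k=1..n. 1 / real k)"
proof -
  have "{d. d \<in> {1..n} \<and> l dvd d} = {d. d \<in> {0<..n} \<and> l dvd d}" by auto
  then have "(\<Sum>d | d \<in> {1..n} \<and> l dvd d. 1 / real d) = (\<Sum>m\<in>{Suc 0..<Suc (n div l)}. 1 / real (l * m))"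
    using sum_multiples_greaterThanAtMost[OF assms, of "\<lambda>d. 1 / real d" 0 n] by simp
  also have "\<dots> = 1 / real l * (\<Sum>k=1..n div l. 1 / real k)"
    by (simp add: sum_distrib_left atLeastLessThanSuc_atLeastAtMost)
  also have "\<dots> \<le> 1 / real l * (\<Sum>k=1..n. 1 / real k)"
    using div_le_dividend[of n l] by (intro mult_left_mono sum_mono2) auto
  finally show ?thesis .
qed

text \<open>Exchanging the sums over \<open>n\<close> and \<open>d\<close> leaves one sum over
  multiples for each \<open>d\<close>. The \<open>d\<close> divisible by \<open>l\<close> give the
  first harmonic sum, and equidistribution of \<open>d * j\<close> modulo \<open>l\<close> gives the
  second.\<close>

lemma norm_sieve_exponential_sum_le:
  fixes g :: "nat \<Rightarrow> complex"
  assumes "coprime j l" "l > 0" "G \<ge> 0" "\<And>d. 1 \<le> d \<Longrightarrow> d \<le> Q \<Longrightarrow> norm (g d) \<le> G"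
  shows "norm (\<Sum>n\<in>{N<..2 * N}. (\<Sum>d | d dvd n \<and> d \<le> Q. g d) * e (real n * (real j / real l)))
    \<le> G * (2 * real N / real l * (\<Sum>k=1..2 * N. 1 / real k)
           + 2 * (real Q + real l) * (\<Sum>k=1..l. 1 / real k))"
proof -
  let ?S = "\<lambda>d. \<Sum>n | n \<in> {N<..2 * N} \<and> d dvd n. e (real n * (real j / real l))"
  \<comment> \<open>Divisors of \<open>n <= 2 * N\<close> do not exceed \<open>2 * N\<close>. Both
    cutoffs are useful: the first part is extended to \<open>2 * N\<close>, the second to
    \<open>Q\<close>.\<close>
  define D where "D = min Q (2 * N)"
  have S0: "(\<Sum>n\<in>{N<..2 * N}. (\<Sum>d | d dvd n \<and> d \<le> Q. g d) * e (real n * (real j / real l)))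
     = (\<Sum>d=1..D. g d * ?S d)"
  proof -
    have "(\<Sum>n\<in>{N<..2 * N}. (\<Sum>d | d dvd n \<and> d \<le> Q. g d) * e (real n * (real j / real l)))
      = (\<Sum>n\<in>{N<..2 * N}. \<Sum>d | d \<in> {1..D} \<and> d dvd n. g d * e (real n * (real j / real l)))"
    proof (rule sum.cong[OF refl])
      fix n assume n: "n \<in> {N<..2 * N}"
      have "{d. d dvd n \<and> d \<le> Q} = {d. d \<in> {1..D} \<and> d dvd n}"
        using n by (auto simp: D_def Suc_le_eq dest: dvd_imp_le intro: Nat.gr0I)
      then show "(\<Sum>d | d dvd n \<and> d \<le> Q. g d) * e (real n * (real j / real l))
         = (\<Sum>d | d \<in> {1..D} \<and> d dvd n. g d * e (real n * (real j / real l)))"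
        by (simp add: sum_distrib_right)
    qed
    also have "\<dots> = (\<Sum>d=1..D. \<Sum>n | n \<in> {N<..2 * N} \<and> d dvd n. g d * e (real n * (real j / real l)))"
      by (rule sum.swap_restrict) auto
    finally show ?thesis by (simp add: sum_distrib_left)
  qed
  have "norm (\<Sum>d=1..D. g d * ?S d) \<le> (\<Sum>d=1..D. norm (g d) * norm (?S d))"
    by (rule order_trans[OF norm_sum]) (simp add: norm_mult)
  also have "\<dots> \<le> (\<Sum>d=1..D. G * ((if l dvd d then 2 * real N / real d else 0) + residue_weight l (d * j mod l)))"
    using assms by (intro sum_mono mult_mono norm_sum_e_multiples_le) (auto simp: D_def)
  also have "\<dots> = G * ((\<Sum>d=1..D. if l dvd d then 2 * real N / real d else 0) + (\<Sum>d=1..D. residue_weight l (d * j mod l)))"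
    by (simp add: sum.distrib sum_distrib_left distrib_left)
  also have "\<dots> \<le> G * (2 * real N / real l * (\<Sum>k=1..2 * N. 1 / real k)
           + 2 * (real Q + real l) * (\<Sum>k=1..l. 1 / real k))"
  proof (intro mult_left_mono add_mono)
    have "(\<Sum>d=1..D. if l dvd d then 2 * real N / real d else 0) \<le> (\<Sum>d=1..2*N. if l dvd d then 2 * real N / real d else 0)"
      by (intro sum_mono2) (auto simp: D_def)
    also have "\<dots> = 2 * real N * (\<Sum>d | d \<in> {1..2 * N} \<and> l dvd d. 1 / real d)"
      unfolding sum_distrib_left by (subst sum.inter_filter) (auto intro!: sum.cong)
    also have "\<dots> \<le> 2 * real N * (1 / real l * (\<Sum>k=1..2 * N. 1 / real k))"
      using assms by (intro mult_left_mono sum_inverse_multiples_le) auto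
    finally show "(\<Sum>d=1..D. if l dvd d then 2 * real N / real d else 0) \<le> 2 * real N / real l * (\<Sum>k=1..2 * N. 1 / real k)"
      by simp
    have "(\<Sum>d=1..D. residue_weight l (d * j mod l)) \<le> (\<Sum>d=1..Q. residue_weight l (d * j mod l))"
      by (intro sum_mono2) (auto simp: D_def residue_weight_nonneg)
    also have "\<dots> \<le> (real Q / real l + 1) * (\<Sum>r<l. residue_weight l r)"
      using assms by (intro sum_periodic_le) (auto simp: residue_weight_nonneg)
    also have "\<dots> \<le> (real Q / real l + 1) * (2 * real l * (\<Sum>k=1..l. 1 / real k))"
      by (intro mult_left_mono sum_residue_weight_le) auto
    also have "\<dots> = 2 * (real Q + real l) * (\<Sum>k=1..l. 1 / real k)"
      using assms by (simp add: field_simps)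
    finally show "(\<Sum>d=1..D. residue_weight l (d * j mod l)) \<le> 2 * (real Q + real l) * (\<Sum>k=1..l. 1 / real k)" .
  qed (fact assms)
  finally show ?thesis unfolding S0 .
qed

section \<open>Reduction to exponential sums\<close>

text \<open>Orthogonality turns the congruence into a sum over all frequencies \<open>j < q\<close>.
  As \<open>f\<close> is real, conjugating its exponential sum amounts to negating the
  frequency.\<close>

lemma T_eq_exponential_sums:
  assumes "q > 0"
  shows "complex_of_real (T w f q N H) = 1 / of_nat q *
    (\<Sum>j=1..<q. w_hat w H (real j / real q)
       * cnj (\<Sum>n\<in>{N<..2 * N}. of_real (f n) * e (real n * (real j / real q))))"
proof -
  let ?I = "{- int H..int H}" and ?J = "{N<..2 * N}"
  define F where "F j = cnj (\<Sum>n\<in>?J. of_real (f n) * e (real n * (real j / real q)))" for j :: nat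
  have prod: "e (of_int a * (real j / real q)) * cnj (e (real n * (real j / real q)))
      = e (real j * (of_int (a - int n) / real q))" for a n j
    by (simp add: diff_divide_distrib algebra_simps flip: e_uminus e_add)
  have "(\<Sum>j<q. w_hat w H (real j / real q) * F j)
      = (\<Sum>j<q. \<Sum>a\<in>?I. \<Sum>n\<in>?J. of_real (w (of_int a)) * of_real (f n)
           * e (real j * (of_int (a - int n) / real q)))"
    by (simp only: w_hat_def F_def cnj_sum sum_product complex_cnj_mult complex_cnj_complex_of_real prod[symmetric])
       (simp only: mult_ac)
  also have "\<dots> = (\<Sum>a\<in>?I. \<Sum>n\<in>?J. \<Sum>j<q. of_real (w (of_int a)) * of_real (f n)
           * e (real j * (of_int (a - int n) / real q)))"
    by (subst sum.swap, rule sum.cong[OF refl], subst sum.swap, rule refl)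
  also have "\<dots> = (\<Sum>a\<in>?I. \<Sum>n\<in>?J. of_real (w (of_int a)) * of_real (f n)
           * (if [int n = a] (mod int q) then of_nat q else 0))"
    using assms by (simp only: sum_distrib_left[symmetric] sum_e_residue cong_iff_dvd_diff dvd_diff_commute)
  also have "\<dots> = of_nat q * (\<Sum>a\<in>?I. of_real (w (of_int a)) * (\<Sum>n | n \<in> ?J \<and> [int n = a] (mod int q). of_real (f n)))"
    by (subst sum.inter_filter) (auto simp: sum_distrib_left mult_ac intro!: sum.cong)
  finally have all: "(\<Sum>j<q. w_hat w H (real j / real q) * F j) = \<dots>" .
  \<comment> \<open>The frequency 0 is split off: its term is exactly \<open>q\<close> times the
    main term subtracted in \<open>T\<close>.\<close>
  have "{..<q} = insert 0 {1..<q}" using assms by auto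
  then have "(\<Sum>j<q. w_hat w H (real j / real q) * F j)
     = w_hat w H 0 * F 0 + (\<Sum>j=1..<q. w_hat w H (real j / real q) * F j)"
    by simp
  moreover have "w_hat w H 0 = of_real (\<Sum>h\<in>?I. w (of_int h))"
    by (simp add: w_hat_def e_def)
  moreover have "F 0 = of_real (\<Sum>n\<in>?J. f n)"
    by (simp add: F_def e_def)
  moreover have "of_nat q * complex_of_real (T w f q N H)
      = of_nat q * (\<Sum>a\<in>?I. of_real (w (of_int a)) * (\<Sum>n | n \<in> ?J \<and> [int n = a] (mod int q). of_real (f n)))
        - of_real (\<Sum>h\<in>?I. w (of_int h)) * of_real (\<Sum>n\<in>?J. f n)"
    using assms by (simp add: T_def right_diff_distrib)
  ultimately have "(\<Sum>j=1..<q. w_hat w H (real j / real q) * F j) = of_nat q * complex_of_real (T w f q N H)"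
    using all by simp
  then show ?thesis using assms by (simp add: F_def)
qed

section \<open>Grouping frequencies by reduced denominator\<close>

lemma L1_nonneg: "L1 w H l \<ge> 0"
  by (simp add: L1_def sum_nonneg)

lemma L1_le_max_L1:
  assumes "q > 0" "l > 1" "l dvd q"
  shows "L1 w H l \<le> max_L1 w H q"
proof -
  have "finite {L1 w H l | l. l > 1 \<and> l dvd q}"
    using assms by (auto intro!: finite_image_set finite_subset[OF _ finite_divisors_nat[of q]])
  moreover have "q \<noteq> 1" using assms by auto
  ultimately show ?thesis
    using assms by (auto simp: max_L1_def intro!: Max_ge)
qed

lemma max_L1_nonneg:
  assumes "q > 0"
  shows "max_L1 w H q \<ge> 0"
proof (cases "q = 1")
  case False
  then show ?thesis
    using assms L1_le_max_L1[of q q w H] L1_nonneg[of w H q] by simp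
qed (simp add: max_L1_def)

text \<open>Cancelling the gcd sends each numerator \<open>x\<close> to a reduced pair
  \<open>(l, j)\<close>, from which \<open>j * (q div l)\<close> recovers \<open>x\<close>. Since
  \<open>F\<close> is nonnegative, this covering suffices for the inequality.\<close>

lemma sum_fractions_le_sum_reduced_fractions:
  fixes F :: "real \<Rightarrow> real"
  assumes "q > 0" "\<And>x. F x \<ge> 0"
  shows "(\<Sum>j=1..<q. F (real j / real q))
      \<le> (\<Sum>l | l > 1 \<and> l dvd q. \<Sum>j | j < l \<and> coprime j l. F (real j / real l))"
proof -
  have fin: "finite {l. l > 1 \<and> l dvd q}"
    using assms by (auto intro!: finite_subset[OF _ finite_divisors_nat[of q]])
  have "(\<Sum>j=1..<q. F (real j / real q))
     \<le> (\<Sum>(l, j)\<in>Sigma {l. l > 1 \<and> l dvd q} (\<lambda>l. {j. j < l \<and> coprime j l}). F (real j / real l))"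
  proof (rule sum_le_included[where i = "\<lambda>(l, j). j * (q div l)"])
    show "\<forall>x\<in>{1..<q}. \<exists>y\<in>Sigma {l. l > 1 \<and> l dvd q} (\<lambda>l. {j. j < l \<and> coprime j l}).
        (case y of (l, j) \<Rightarrow> j * (q div l)) = x \<and> F (real x / real q) \<le> (case y of (l, j) \<Rightarrow> F (real j / real l))"
    proof
      fix x assume x: "x \<in> {1..<q}"
      define c where "c = gcd x q"
      have c: "c > 0" using assms by (simp add: c_def)
      obtain j l where jl: "x = j * c" "q = l * c" "coprime j l"
        using gcd_coprime_exists[of x q] c unfolding c_def by auto
      have "j < l" using x jl c by auto
      moreover have "j > 0" using x jl by (cases j) auto
      ultimately have "l > 1" by simp
      have "real x / real q = real j / real l" using jl c by simp
      moreover have "j * (q div l) = x" using jl \<open>l > 1\<close> by simp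
      ultimately show "\<exists>y\<in>Sigma {l. l > 1 \<and> l dvd q} (\<lambda>l. {j. j < l \<and> coprime j l}).
        (case y of (l, j) \<Rightarrow> j * (q div l)) = x \<and> F (real x / real q) \<le> (case y of (l, j) \<Rightarrow> F (real j / real l))"
        using \<open>j < l\<close> \<open>l > 1\<close> jl by (intro bexI[of _ "(l, j)"]) auto
    qed
  qed (use fin assms in auto)
  also have "\<dots> = (\<Sum>l | l > 1 \<and> l dvd q. \<Sum>j | j < l \<and> coprime j l. F (real j / real l))"
    using fin by (subst sum.Sigma) auto
  finally show ?thesis .
qed

lemma abs_T_le:
  fixes g :: "nat \<Rightarrow> complex"
  assumes "q > 0" "G \<ge> 0"
    and g: "\<And>d. 1 \<le> d \<Longrightarrow> d \<le> Q \<Longrightarrow> norm (g d) \<le> G"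
    and f: "\<And>n. n \<ge> 1 \<Longrightarrow> complex_of_real (f n) = (\<Sum>d | d dvd n \<and> d \<le> Q. g d)"
    and h: "(\<Sum>k=1..2 * N. 1 / real k) \<le> h" "(\<Sum>k=1..q. 1 / real k) \<le> h"
  shows "\<bar>T w f q N H\<bar> \<le> 2 * G * h * real (card {d. d dvd q}) * (real N / real q + real q + real Q) * max_L1 w H q"
proof -
  define F where "F x = (\<Sum>n\<in>{N<..2 * N}. complex_of_real (f n) * e (real n * x))" for x
  \<comment> \<open>Since \<open>l <= q\<close>, the quotient \<open>E / l\<close> dominates
    \<open>N / l + l + Q\<close>. Its explicit \<open>1 / l\<close> completes the sum over
    \<open>j\<close> to \<open>L1 w H l\<close>, and the outer \<open>1 / q\<close> turns
    \<open>E\<close> into the final factor.\<close>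
  define E where "E = real N + real q * real q + real Q * real q"
  have fin: "finite {l. l > 1 \<and> l dvd q}"
    using assms by (auto intro!: finite_subset[OF _ finite_divisors_nat[of q]])
  have h0: "h \<ge> 0" using order_trans[OF sum_nonneg h(2)] by simp
  have Fle: "norm (F (real j / real l)) \<le> 2 * G * h * (E / real l)"
    if "coprime j l" "l dvd q" for j l
  proof -
    have l: "l > 0" "l \<le> q" using that assms by (auto intro: dvd_imp_le Nat.gr0I)
    have "(\<Sum>k=1..l. 1 / real k) \<le> (\<Sum>k=1..q. 1 / real k)"
      using l by (intro sum_mono2) auto
    then have hl: "(\<Sum>k=1..l. 1 / real k) \<le> h" using h by linarith
    have "F (real j / real l) = (\<Sum>n\<in>{N<..2 * N}. (\<Sum>d | d dvd n \<and> d \<le> Q. g d) * e (real n * (real j / real l)))"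
      unfolding F_def by (intro sum.cong) (auto simp: f)
    also have "norm \<dots> \<le> G * (2 * real N / real l * (\<Sum>k=1..2 * N. 1 / real k)
           + 2 * (real Q + real l) * (\<Sum>k=1..l. 1 / real k))"
      using that l assms by (intro norm_sieve_exponential_sum_le) auto
    also have "\<dots> \<le> G * (2 * real N / real l * h + 2 * (real Q + real l) * h)"
      using assms hl by (intro mult_left_mono add_mono) auto
    also have "\<dots> = 2 * G * h * ((real N + real l * real l + real Q * real l) / real l)"
      using l by (simp add: field_simps)
    also have "\<dots> \<le> 2 * G * h * (E / real l)"
      unfolding E_def using l assms h0 by (intro mult_left_mono divide_right_mono add_mono mult_mono) auto
    finally show ?thesis .
  qed
  have "\<bar>T w f q N H\<bar> = norm (complex_of_real (T w f q N H))" by simp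
  also have "\<dots> = 1 / real q * norm (\<Sum>j=1..<q. w_hat w H (real j / real q) * cnj (F (real j / real q)))"
    unfolding T_eq_exponential_sums[OF assms(1)] F_def by (simp add: norm_mult norm_divide)
  also have "\<dots> \<le> 1 / real q * (\<Sum>j=1..<q. norm (w_hat w H (real j / real q)) * norm (F (real j / real q)))"
    by (intro mult_left_mono order_trans[OF norm_sum]) (simp_all add: norm_mult)
  also have "\<dots> \<le> 1 / real q * (\<Sum>l | l > 1 \<and> l dvd q. \<Sum>j | j < l \<and> coprime j l.
       norm (w_hat w H (real j / real l)) * norm (F (real j / real l)))"
    using assms sum_fractions_le_sum_reduced_fractions[of q "\<lambda>x. norm (w_hat w H x) * norm (F x)"]
    by (intro mult_left_mono) auto
  also have "\<dots> \<le> 1 / real q * (\<Sum>l | l > 1 \<and> l dvd q. \<Sum>j | j < l \<and> coprime j l.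
       norm (w_hat w H (real j / real l)) * (2 * G * h * (E / real l)))"
    by (intro mult_left_mono sum_mono Fle) auto
  also have "\<dots> = 1 / real q * (\<Sum>l | l > 1 \<and> l dvd q. L1 w H l * (2 * G * h * E))"
    by (simp add: L1_def sum_distrib_left sum_distrib_right mult_ac)
  also have "\<dots> \<le> 1 / real q * (\<Sum>l | l > 1 \<and> l dvd q. max_L1 w H q * (2 * G * h * E))"
    using assms h0 by (intro mult_left_mono sum_mono mult_right_mono L1_le_max_L1) (auto simp: E_def)
  also have "\<dots> = real (card {l. l > 1 \<and> l dvd q}) * (2 * G * h * (E / real q) * max_L1 w H q)"
    by simp
  also have "\<dots> \<le> real (card {l. l dvd q}) * (2 * G * h * (E / real q) * max_L1 w H q)"
  proof (rule mult_right_mono)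
    show "real (card {l. l > 1 \<and> l dvd q}) \<le> real (card {l. l dvd q})"
      using assms unfolding of_nat_le_iff by (intro card_mono) auto
    show "0 \<le> 2 * G * h * (E / real q) * max_L1 w H q"
      using assms h0 by (intro mult_nonneg_nonneg max_L1_nonneg) (auto simp: E_def)
  qed
  also have "E / real q = real N / real q + real q + real Q"
    using assms by (simp add: E_def field_simps)
  finally show ?thesis by (simp only: mult_ac)
qed

text \<open>\<open>A\<close>, \<open>B\<close> and \<open>K\<close> fix the implied constants in the
  bounds on \<open>q\<close>, \<open>Q\<close> and \<open>g\<close>. The constant \<open>C\<close>
  is chosen after these and \<open>\<epsilon>\<close>, so it is uniform in \<open>q\<close>,
  \<open>N\<close>, \<open>H\<close>, \<open>Q\<close>, \<open>f\<close> and
  \<open>w\<close>.\<close>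

theorem theorem1:
  fixes K :: "real \<Rightarrow> real" and A B \<epsilon> :: real
  assumes "\<epsilon> > 0"
  shows "\<exists>C::real. \<forall>(q::nat) (N::nat) (H::nat) (Q::nat) (f::nat \<Rightarrow> real) (w::real \<Rightarrow> real).
           q > 0 \<and> N > 0 \<and> H > 0 \<and> Q > 0
           \<and> real q \<le> A * real N \<and> real Q \<le> B * real N
           \<and> sieve_function K Q f
           \<longrightarrow> \<bar>T w f q N H\<bar>
                 \<le> C * real N powr \<epsilon> * (real N / real q + real q + real Q) * max_L1 w H q"
proof -
  \<comment> \<open>Three factors each lose a power \<open>\<delta>\<close>: the size of
    \<open>g\<close>, the harmonic sums and the number of divisors of \<open>q\<close>.\<close>
  define \<delta> where "\<delta> = \<epsilon> / 3"
  have \<delta>: "\<delta> > 0" using assms by (simp add: \<delta>_def)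
  obtain C where C: "C > 0" "\<And>n. n > 0 \<Longrightarrow> real (card {d. d dvd n}) \<le> C * real n powr \<delta>"
    using card_divisors_le_powr[OF \<delta>] by blast
  \<comment> \<open>A single multiple \<open>R * N\<close> bounds \<open>2 * N\<close>,
    \<open>q\<close> and \<open>Q\<close>, so all three losses are measured by the same
    \<open>Y\<close>.\<close>
  define R where "R = max 2 (max A B)"
  have R: "2 \<le> R" "A \<le> R" "B \<le> R" by (auto simp: R_def)
  \<comment> \<open>The absolute value makes the bound on \<open>g\<close> nonnegative before any
    \<open>g\<close> is given; the cube collects the factor \<open>R powr \<delta>\<close> from the
    three copies of \<open>Y\<close>.\<close>
  define M where "M = 2 * \<bar>K \<delta>\<bar> * (1 + 1 / \<delta>) * C * (R powr \<delta>) ^ 3"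
  show ?thesis
  proof (intro exI[of _ M] allI impI, elim conjE)
    fix q N H Q :: nat and f w
    assume pos: "q > 0" "N > 0" "H > 0" "Q > 0"
      and qA: "real q \<le> A * real N" and QB: "real Q \<le> B * real N"
      and sieve: "sieve_function K Q f"
    obtain g where g: "essentially_bounded_by K g"
      and f: "\<And>n. n \<ge> 1 \<Longrightarrow> complex_of_real (f n) = (\<Sum>d | d dvd n \<and> d \<le> Q. g d)"
      using sieve unfolding sieve_function_def by blast
    have NR: "real (2 * N) \<le> R * real N" "real q \<le> R * real N" "real Q \<le> R * real N"
      using qA QB R[THEN mult_right_mono, of "real N"] by auto
    define Y where "Y = (R * real N) powr \<delta>"
    have Y: "Y = R powr \<delta> * real N powr \<delta>" by (simp add: Y_def powr_mult R_def)
    have "norm (g d) \<le> \<bar>K \<delta>\<bar> * Y" if "1 \<le> d" "d \<le> Q" for d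
    proof -
      have "norm (g d) \<le> K \<delta> * real d powr \<delta>"
        using g \<delta> that unfolding essentially_bounded_by_def by blast
      also have "\<dots> \<le> \<bar>K \<delta>\<bar> * Y"
        unfolding Y_def using \<delta> that NR by (intro mult_mono powr_mono2) auto
      finally show ?thesis .
    qed
    moreover have "(\<Sum>k=1..2 * N. 1 / real k) \<le> (1 + 1 / \<delta>) * Y" "(\<Sum>k=1..q. 1 / real k) \<le> (1 + 1 / \<delta>) * Y"
      unfolding Y_def using pos NR \<delta> by (auto intro!: sum_inverse_le_powr simp del: One_nat_def)
    ultimately have "\<bar>T w f q N H\<bar> \<le> 2 * (\<bar>K \<delta>\<bar> * Y) * ((1 + 1 / \<delta>) * Y) * real (card {d. d dvd q})
        * (real N / real q + real q + real Q) * max_L1 w H q"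
      using pos f by (intro abs_T_le) (auto simp: Y_def)
    also have "\<dots> \<le> 2 * (\<bar>K \<delta>\<bar> * Y) * ((1 + 1 / \<delta>) * Y) * (C * Y)
        * (real N / real q + real q + real Q) * max_L1 w H q"
    proof (intro mult_right_mono mult_left_mono)
      have "C * real q powr \<delta> \<le> C * Y"
        unfolding Y_def using \<delta> C NR by (intro mult_left_mono powr_mono2) auto
      with C(2)[OF pos(1)] show "real (card {d. d dvd q}) \<le> C * Y" by linarith
    qed (use pos \<delta> max_L1_nonneg in \<open>auto simp: Y_def\<close>)
    also have "2 * (\<bar>K \<delta>\<bar> * Y) * ((1 + 1 / \<delta>) * Y) * (C * Y) = M * (real N powr \<delta>) ^ 3"
      by (simp add: M_def Y power3_eq_cube mult_ac)
    also have "(real N powr \<delta>) ^ 3 = real N powr \<epsilon>"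
      using pos by (simp add: \<delta>_def powr_powr flip: powr_realpow)
    finally show "\<bar>T w f q N H\<bar> \<le> M * real N powr \<epsilon> * (real N / real q + real q + real Q) * max_L1 w H q" .
  qed
qed

end
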